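(* Let $(x_n)_{n\in\mathbb N}$ be a normalized weakly null sequence in a Banach space $X$. Then $(x_n)_{n\in\mathbb N}$ has a convexly unconditional subsequence.
   Context: Normalized means $\|x_n\|=1$ for all $n$; weakly null means $x_n\to 0$ weakly. A normalized sequence $(x_n)_{n\in\mathbb N}$ in a Banach space is called convexly unconditional if for every $\delta>0$ there exists $C(\delta)>0$ such that whenever an absolutely convex combination $x=\sum_{n=1}^\infty a_nx_n$ (i.e. $\sum_{n=1}^\infty|a_n|\le 1$) satisfies $\|x\|>\delta$, then $\left\|\sum_{n=1}^\infty\varepsilon_na_nx_n\right\|>C(\delta)$ for every choice of signs $(\varepsilon_n)_{n\in\mathbb N}$, $\varepsilon_n\in\{-1,1\}$. *)

theory Defs
  imports "HOL-Analysis.Analysis"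
begin

definition normalized :: "(nat \<Rightarrow> 'a::real_normed_vector) \<Rightarrow> bool"
  where "normalized x \<longleftrightarrow> (\<forall>n. norm (x n) = 1)"

definition weakly_null :: "(nat \<Rightarrow> 'a::real_normed_vector) \<Rightarrow> bool"
  where "weakly_null x \<longleftrightarrow> (\<forall>f :: 'a \<Rightarrow>\<^sub>L real. (\<lambda>n. blinfun_apply f (x n)) \<longlonglongrightarrow> 0)"

(* suminf is a junk value on divergent series, so the condition "the sum of the |a n| is
   at most 1" needs summability as a separate conjunct. The two vector series below then converge,
   because x is normalized and the space is complete. *)
definition convexly_unconditional :: "(nat \<Rightarrow> 'a::banach) \<Rightarrow> bool"
  where "convexly_unconditional x \<longleftrightarrow>
    normalized x \<and>
    (\<forall>\<delta>::real. \<delta> > 0 \<longrightarrow>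
      (\<exists>C::real. C > 0 \<and>
        (\<forall>a :: nat \<Rightarrow> real.
          summable (\<lambda>n. \<bar>a n\<bar>) \<and> (\<Sum>n. \<bar>a n\<bar>) \<le> 1 \<and> norm (\<Sum>n. a n *\<^sub>R x n) > \<delta> \<longrightarrow>
          (\<forall>\<epsilon> :: nat \<Rightarrow> real. (\<forall>n. \<epsilon> n \<in> {-1, 1}) \<longrightarrow>
            norm (\<Sum>n. (\<epsilon> n * a n) *\<^sub>R x n) > C))))"

end

theory Submission
  imports Defs
begin

text \<open>
  If a functional \<open>f\<close> in the dual unit ball is at least \<open>2\<^sup>-\<^sup>i\<close> on a set \<open>F\<close> of terms of a suitable
  subsequence, then some \<open>g\<close> in the ball is still at least \<open>2\<^sup>-\<^sup>i\<close> on \<open>F\<close> and satisfies, at each other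
  index \<open>j \<ge> i\<close>, a prescribed one of the inequalities \<open>g \<ge> - \<eta>\<^sub>j\<close> and \<open>g \<le> \<eta>\<^sub>j\<close>, where
  \<open>\<eta>\<^sub>j = 4\<^sup>-\<^sup>j / 8\<close>. One-sided control suffices: the side is chosen by the sign of the coefficient.
  Such a subsequence is picked generically for a nonprincipal ultrafilter. The only analytic input is
  that, by weak nullity, every infinite set of indices contains a finite set \<open>S\<close> such that each \<open>f\<close>
  in the ball satisfies \<open>f (x n) \<le> \<eta>\<close> for some \<open>n\<close> in \<open>S\<close>.

  Given a combination of large norm, a norming functional is large on a set of terms carrying a
  definite part of the weight. Restricting to indices where the functional and the coefficients after the
  change of signs have constant sign, \<open>g\<close> witnesses a lower bound for the new combination. Taking
  \<open>F\<close> a singleton bounds all coefficients by the norm, which deals with the initial terms that a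
  given \<open>i\<close> does not control.
\<close>

section \<open>Norming functionals\<close>

text \<open>The cones below play the role of epigraphs of sublinear functionals \<open>p\<close> with \<open>p \<le> norm\<close> and
  \<open>p (- y) \<le> - norm y\<close>; a maximal one is the epigraph of a linear functional.\<close>

lemma norming_functional:
  fixes y :: "'a::real_normed_vector"
  shows "\<exists>f :: 'a \<Rightarrow>\<^sub>L real. norm f \<le> 1 \<and> blinfun_apply f y = norm y"
proof -
  define cones :: "('a \<times> real) set set" where
    "cones = {G. (\<forall>x t. norm x \<le> t \<longrightarrow> (x, t) \<in> G) \<and> (- y, - norm y) \<in> G
      \<and> (\<forall>x t x' t'. (x, t) \<in> G \<longrightarrow> (x', t') \<in> G \<longrightarrow> (x + x', t + t') \<in> G)
      \<and> (\<forall>c x t. 0 < c \<longrightarrow> (x, t) \<in> G \<longrightarrow> (c *\<^sub>R x, c * t) \<in> G)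
      \<and> (\<forall>t. (0, t) \<in> G \<longrightarrow> 0 \<le> t)}"
  \<comment> \<open>\<open>?G\<close> is the cone generated by the epigraph of the norm and the
    point \<open>(- y, - norm y)\<close>; \<open>s\<close> is the multiple of that point.\<close>
  have "{(x, t). \<exists>s\<ge>0. norm (x + s *\<^sub>R y) - s * norm y \<le> t} \<in> cones" (is "?G \<in> _")
    unfolding cones_def mem_Collect_eq case_prod_conv
  proof (intro conjI allI impI)
    fix x :: 'a and t :: real assume "norm x \<le> t"
    then show "\<exists>s\<ge>0. norm (x + s *\<^sub>R y) - s * norm y \<le> t" by (intro exI[of _ 0]) auto
  next
    show "\<exists>s\<ge>0. norm (- y + s *\<^sub>R y) - s * norm y \<le> - norm y" by (intro exI[of _ 1]) auto
  next
    fix x x' :: 'a and t t' :: real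
    assume "\<exists>s\<ge>0. norm (x + s *\<^sub>R y) - s * norm y \<le> t"
      and "\<exists>s\<ge>0. norm (x' + s *\<^sub>R y) - s * norm y \<le> t'"
    then obtain s s' where s: "s \<ge> 0" "norm (x + s *\<^sub>R y) - s * norm y \<le> t"
      and s': "s' \<ge> 0" "norm (x' + s' *\<^sub>R y) - s' * norm y \<le> t'" by blast
    have "norm (x + x' + (s + s') *\<^sub>R y) \<le> norm (x + s *\<^sub>R y) + norm (x' + s' *\<^sub>R y)"
      using norm_triangle_ineq[of "x + s *\<^sub>R y" "x' + s' *\<^sub>R y"] by (simp add: algebra_simps)
    then show "\<exists>s\<ge>0. norm (x + x' + s *\<^sub>R y) - s * norm y \<le> t + t'"
      using s s' by (intro exI[of _ "s + s'"]) (auto simp: algebra_simps)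
  next
    fix c t :: real and x :: 'a
    assume c: "0 < c" and "\<exists>s\<ge>0. norm (x + s *\<^sub>R y) - s * norm y \<le> t"
    then obtain s where s: "s \<ge> 0" "norm (x + s *\<^sub>R y) - s * norm y \<le> t" by blast
    have "norm (c *\<^sub>R x + (c * s) *\<^sub>R y) - (c * s) * norm y = c * (norm (x + s *\<^sub>R y) - s * norm y)"
      using c norm_scaleR[of c "x + s *\<^sub>R y"] by (simp add: algebra_simps)
    also have "\<dots> \<le> c * t" using c s by simp
    finally show "\<exists>s\<ge>0. norm (c *\<^sub>R x + s *\<^sub>R y) - s * norm y \<le> c * t"
      using c s by (intro exI[of _ "c * s"]) auto
  next
    fix t :: real assume "\<exists>s\<ge>0. norm (0 + s *\<^sub>R y) - s * norm y \<le> t"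
    then show "0 \<le> t" by auto
  qed
  then have "cones \<noteq> {}" by blast
  moreover have "\<Union>\<C> \<in> cones" if "\<C> \<noteq> {}" "subset.chain cones \<C>" for \<C>
  proof -
    have sub: "G \<in> cones" if "G \<in> \<C>" for G
      using that \<open>subset.chain cones \<C>\<close> by (auto simp: subset.chain_def)
    have "\<exists>G\<in>\<C>. p \<in> G \<and> q \<in> G" if "p \<in> \<Union>\<C>" "q \<in> \<Union>\<C>" for p q
      using that \<open>subset.chain cones \<C>\<close> unfolding subset_chain_def by blast
    note directed = this
    have add: "(x + x', t + t') \<in> \<Union>\<C>" if xx': "(x, t) \<in> \<Union>\<C>" "(x', t') \<in> \<Union>\<C>" for x t x' t'
    proof -
      obtain G where "G \<in> \<C>" "(x, t) \<in> G" "(x', t') \<in> G" using directed[OF xx'] by blast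
      then show ?thesis using sub[of G] unfolding cones_def by blast
    qed
    obtain G where "G \<in> \<C>" using \<open>\<C> \<noteq> {}\<close> by blast
    have 1: "\<forall>x t. norm x \<le> t \<longrightarrow> (x, t) \<in> \<Union>\<C>" "(- y, - norm y) \<in> \<Union>\<C>"
      using \<open>G \<in> \<C>\<close> sub[OF \<open>G \<in> \<C>\<close>] unfolding cones_def by blast+
    have 2: "\<forall>c x t. 0 < c \<longrightarrow> (x, t) \<in> \<Union>\<C> \<longrightarrow> (c *\<^sub>R x, c * t) \<in> \<Union>\<C>" "\<forall>t. (0, t) \<in> \<Union>\<C> \<longrightarrow> 0 \<le> t"
      using sub unfolding cones_def by blast+
    show ?thesis using add 1 2 unfolding cones_def mem_Collect_eq by blast
  qed
  ultimately obtain G where "G \<in> cones" and max: "\<forall>H\<in>cones. G \<subseteq> H \<longrightarrow> H = G"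
    using subset_Zorn_nonempty[of cones] by blast
  then have nrm: "\<And>x t. norm x \<le> t \<Longrightarrow> (x, t) \<in> G" and y: "(- y, - norm y) \<in> G"
    and add: "\<And>x t x' t'. (x, t) \<in> G \<Longrightarrow> (x', t') \<in> G \<Longrightarrow> (x + x', t + t') \<in> G"
    and scale: "\<And>c x t. 0 < c \<Longrightarrow> (x, t) \<in> G \<Longrightarrow> (c *\<^sub>R x, c * t) \<in> G"
    and pos: "\<And>t. (0, t) \<in> G \<Longrightarrow> 0 \<le> t"
    unfolding cones_def by blast+
  have opp: "0 \<le> t + t'" if "(x, t) \<in> G" "(- x, t') \<in> G" for x t t'
    using add[OF that] pos by simp
  \<comment> \<open>By maximality, adjoining the ray through \<open>(x, t)\<close> to
    \<open>G\<close> must violate the last cone condition. The resulting pair \<open>(0, u)\<close>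
    with \<open>u < 0\<close> is then solved for \<open>- x\<close>.\<close>
  have dich: "\<exists>t'. t' < - t \<and> (- x, t') \<in> G" if "(x, t) \<notin> G" for x t
  proof -
    define H where "H = {(z + s *\<^sub>R x, u + s * t) |z u s. (z, u) \<in> G \<and> 0 \<le> s}"
    have HI: "(z, u) \<in> G \<Longrightarrow> 0 \<le> s \<Longrightarrow> (z + s *\<^sub>R x, u + s * t) \<in> H" for z u s
      unfolding H_def by blast
    have "G \<subseteq> H" using HI[where s = 0] by auto
    moreover have "(x, t) \<in> H" using HI[OF nrm[of 0 0], of 1] by simp
    ultimately have "H \<notin> cones" using max that by blast
    moreover have "(z + z', u + u') \<in> H" if zz': "(z, u) \<in> H" "(z', u') \<in> H" for z u z' u'
    proof -
      obtain w r s w' r' s' where "z = w + s *\<^sub>R x" "u = r + s * t" "(w, r) \<in> G" "0 \<le> s"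
        "z' = w' + s' *\<^sub>R x" "u' = r' + s' * t" "(w', r') \<in> G" "0 \<le> s'"
        using zz' unfolding H_def by blast
      then show ?thesis using HI[OF add[of w r w' r'], of "s + s'"] by (simp add: algebra_simps)
    qed
    moreover have "(c *\<^sub>R z, c * u) \<in> H" if c: "0 < c" and z: "(z, u) \<in> H" for c z u
    proof -
      obtain w r s where "z = w + s *\<^sub>R x" "u = r + s * t" "(w, r) \<in> G" "0 \<le> s"
        using z unfolding H_def by blast
      then show ?thesis using HI[OF scale[of c w r], of "c * s"] c by (simp add: algebra_simps)
    qed
    ultimately obtain u where "(0, u) \<in> H" "u < 0"
      using \<open>G \<subseteq> H\<close> nrm y unfolding cones_def mem_Collect_eq by (meson not_le subsetD)
    then obtain z r s where z: "z + s *\<^sub>R x = 0" "r + s * t < 0" "(z, r) \<in> G" "0 \<le> s"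
      unfolding H_def by force
    have "s \<noteq> 0" using z pos[of r] by auto
    then have s: "0 < s" using z by simp
    have "z = - (s *\<^sub>R x)" using z(1) by (simp add: eq_neg_iff_add_eq_0)
    then have "(1 / s) *\<^sub>R z = - x" using s by simp
    then have "(- x, r / s) \<in> G" using scale[of "1 / s" z r] s z by simp
    moreover have "r / s < - t" using s z by (simp add: field_simps)
    ultimately show ?thesis by blast
  qed
  define p where "p x = Inf {t. (x, t) \<in> G}" for x
  have ne: "{t. (x, t) \<in> G} \<noteq> {}" for x using nrm[of x "norm x"] by blast
  have low: "- norm x \<le> t" if "(x, t) \<in> G" for x t
    using opp[OF that nrm[of "- x" "norm x"]] by simp
  then have bdd: "bdd_below {t. (x, t) \<in> G}" for x by (auto simp: bdd_below_def)
  have p_le: "p x \<le> t" if "(x, t) \<in> G" for x t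
    unfolding p_def using that bdd by (simp add: cInf_lower)
  have p_less: "\<exists>t<r. (x, t) \<in> G" if "p x < r" for x r
    using that ne[of x] bdd[of x] unfolding p_def by (auto simp: cInf_less_iff)
  have sub: "p (x + x') \<le> p x + p x'" for x x'
  proof (rule field_le_epsilon)
    fix e :: real assume "0 < e"
    then obtain t t' where "t < p x + e / 2" "(x, t) \<in> G" "t' < p x' + e / 2" "(x', t') \<in> G"
      using p_less[of x "p x + e / 2"] p_less[of x' "p x' + e / 2"] by auto
    then show "p (x + x') \<le> p x + p x' + e" using p_le[OF add[of x t x' t']] by simp
  qed
  have p0: "p 0 = 0"
  proof (rule antisym)
    show "p 0 \<le> 0" using p_le[OF nrm[of 0 0]] by simp
    show "0 \<le> p 0" using p_less[of 0 0] pos by (meson not_le)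
  qed
  have neg: "p (- x) = - p x" for x
  proof (rule antisym)
    show "- p x \<le> p (- x)" using sub[of x "- x"] p0 by simp
    \<comment> \<open>Nothing below the infimum lies in \<open>G\<close>, so \<open>dich\<close>
      supplies elements over \<open>- x\<close>. Maximality thus makes the sublinear
      \<open>p\<close> odd, hence linear.\<close>
    show "p (- x) \<le> - p x"
    proof (rule dense_ge)
      fix r assume "- p x < r"
      then have "(x, - r) \<notin> G" using p_le by fastforce
      then show "p (- x) \<le> r" using dich p_le by fastforce
    qed
  qed
  have p_add: "p (x + x') = p x + p x'" for x x'
    using sub[of x x'] sub[of "- x" "- x'"] neg[of x] neg[of x'] neg[of "x + x'"] by simp
  have p_pos: "p (c *\<^sub>R x) \<le> c * p x" if "0 < c" for c x
  proof (rule dense_ge)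
    fix r assume "c * p x < r"
    then have "p x < r / c" using that by (simp add: field_simps)
    then obtain t where "t < r / c" "(x, t) \<in> G" using p_less by blast
    then show "p (c *\<^sub>R x) \<le> r" using p_le[OF scale[OF that \<open>(x, t) \<in> G\<close>]] that
      by (simp add: field_simps)
  qed
  have p_pos': "p (c *\<^sub>R x) = c * p x" if "0 < c" for c x
    using p_pos[OF that, of x] p_pos[OF that, of "- x"] by (simp add: neg)
  have p_scale: "p (c *\<^sub>R x) = c * p x" for c x
    using p_pos'[of c x] p_pos'[of "- c" x] neg[of "c *\<^sub>R x"] p0 by (cases "c = 0") (auto simp: neq_iff)
  have p_norm: "\<bar>p x\<bar> \<le> norm x" for x
    using p_le[OF nrm[of x "norm x"]] p_le[OF nrm[of "- x" "norm x"]] neg[of x] by simp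
  have bl: "bounded_linear p"
    by (rule bounded_linear_intro[where K = 1]) (use p_add p_scale p_norm in auto)
  have "norm (Blinfun p) \<le> 1"
    by (rule norm_blinfun_bound) (use p_norm bl in \<open>auto simp: bounded_linear_Blinfun_apply\<close>)
  moreover have "p y = norm y" using p_le[OF y] p_norm[of y] neg[of y] by simp
  ultimately show ?thesis
    using bl by (intro exI[of _ "Blinfun p"]) (simp add: bounded_linear_Blinfun_apply)
qed

lemma blinfun_apply_le_norm:
  fixes f :: "'a::real_normed_vector \<Rightarrow>\<^sub>L real"
  assumes "norm f \<le> 1"
  shows "\<bar>blinfun_apply f z\<bar> \<le> norm z"
  using norm_blinfun[of f z] mult_right_mono[OF assms norm_ge_zero[of z]] by simp

section \<open>Ultrafilters and weakly null sequences\<close>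

text \<open>\<open>le_sequentially\<close> expresses nonprincipality: every cofinite set belongs to
  the filter.\<close>

locale nat_ultrafilter =
  fixes \<U> :: "nat filter"
  assumes proper: "\<U> \<noteq> bot"
    and le_sequentially: "\<U> \<le> sequentially"
    and ultra: "eventually P \<U> \<or> eventually (\<lambda>n. \<not> P n) \<U>"

text \<open>Zorn's lemma for families all of whose finite intersections are infinite. A maximal one
  contains every set or its complement; infinitude of the intersections keeps finite sets out, so
  the generated filter is nonprincipal.\<close>

lemma ex_nat_ultrafilter: "\<exists>\<U>. nat_ultrafilter \<U>"
proof -
  define \<F> :: "nat set set set" where "\<F> = {S. \<forall>T. finite T \<longrightarrow> T \<subseteq> S \<longrightarrow> infinite (\<Inter>T)}"
  have "{} \<in> \<F>" unfolding \<F>_def by simp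
  moreover have "\<Union>\<C> \<in> \<F>" if chain: "\<C> \<noteq> {}" "subset.chain \<F> \<C>" for \<C>
    unfolding \<F>_def mem_Collect_eq
  proof (intro allI impI)
    fix T assume "finite T" "T \<subseteq> \<Union>\<C>"
    then obtain S where "S \<in> \<C>" "T \<subseteq> S"
      by (rule finite_subset_Union_chain[OF _ _ chain])
    then show "infinite (\<Inter>T)" using \<open>finite T\<close> chain(2) unfolding \<F>_def subset_chain_def by blast
  qed
  ultimately obtain M where "M \<in> \<F>" and max: "\<forall>S\<in>\<F>. M \<subseteq> S \<longrightarrow> S = M"
    using subset_Zorn_nonempty[of \<F>] by blast
  have fip: "infinite (\<Inter>T)" if "finite T" "T \<subseteq> M" for T
    using \<open>M \<in> \<F>\<close> that unfolding \<F>_def by blast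
  have ex: "\<exists>T. finite T \<and> T \<subseteq> M \<and> finite (X \<inter> \<Inter>T)" if "X \<notin> M" for X
  proof -
    have "insert X M \<notin> \<F>" using max that by blast
    then obtain T where T: "finite T" "T \<subseteq> insert X M" "finite (\<Inter>T)" unfolding \<F>_def by blast
    have "X \<inter> \<Inter>(T - {X}) \<subseteq> \<Inter>T" by blast
    then show ?thesis using T by (intro exI[of _ "T - {X}"]) (auto intro: finite_subset)
  qed
  have dich: "X \<in> M \<or> - X \<in> M" for X
  proof (rule ccontr)
    assume "\<not> ?thesis"
    then obtain T T' where T: "finite T" "T \<subseteq> M" "finite (X \<inter> \<Inter>T)"
      and T': "finite T'" "T' \<subseteq> M" "finite (- X \<inter> \<Inter>T')" using ex[of X] ex[of "- X"] by blast
    have "\<Inter>(T \<union> T') \<subseteq> (X \<inter> \<Inter>T) \<union> (- X \<inter> \<Inter>T')" by blast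
    then have "finite (\<Inter>(T \<union> T'))" using T(3) T'(3) by (meson finite_UnI finite_subset)
    then show False using fip[of "T \<union> T'"] T T' by blast
  qed
  define \<U> where "\<U> = (INF X\<in>M. principal X)"
  have ev: "eventually (\<lambda>n. n \<in> X) \<U>" if "X \<in> M" for X
    unfolding \<U>_def by (rule eventually_INF1[OF that]) (simp add: eventually_principal)
  have "nat_ultrafilter \<U>"
  proof
    show "\<U> \<noteq> bot" unfolding \<U>_def
    proof (rule INF_filter_not_bot)
      fix T assume T: "T \<subseteq> M" "finite T"
      then have "\<Inter>T \<noteq> {}" using fip[of T] by force
      then show "(INF X\<in>T. principal X) \<noteq> bot"
        using T by (simp add: INF_principal_finite principal_eq_bot_iff)
    qed
    show "eventually P \<U> \<or> eventually (\<lambda>n. \<not> P n) \<U>" for P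
      using dich[of "{n. P n}"] ev[of "{n. P n}"] ev[of "- {n. P n}"] by auto
    show "\<U> \<le> sequentially"
    proof (rule filter_leI)
      fix P assume "eventually P sequentially"
      then obtain k where k: "\<forall>n\<ge>k. P n" unfolding eventually_sequentially by blast
      have "{..<k} \<notin> M" using fip[of "{{..<k}}"] by auto
      then have "- {..<k} \<in> M" using dich by blast
      then have "eventually (\<lambda>n. n \<in> - {..<k}) \<U>" by (rule ev)
      then show "eventually P \<U>" by (rule eventually_mono) (use k in auto)
    qed
  qed
  then show ?thesis ..
qed

context nat_ultrafilter
begin

text \<open>By compactness the image filter has a cluster point in \<open>{-B..B}\<close>, and a
  cluster point of an ultrafilter is a limit.\<close>

lemma bounded_convergent:
  fixes g :: "nat \<Rightarrow> real"
  assumes "\<And>n. \<bar>g n\<bar> \<le> B"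
  shows "\<exists>l. (g \<longlongrightarrow> l) \<U>"
proof -
  let ?F = "filtermap g \<U>"
  have "?F \<noteq> bot" using proper by (simp add: filtermap_bot_iff)
  moreover have "eventually (\<lambda>t. t \<in> {-B..B}) ?F"
    using assms by (auto simp: eventually_filtermap abs_le_iff minus_le_iff)
  ultimately obtain l where l: "inf (nhds l) ?F \<noteq> bot"
    using compact_Icc[of "- B" B] unfolding compact_filter by blast
  have "eventually P ?F" if P: "eventually P (nhds l)" for P
  proof (rule ccontr)
    assume "\<not> eventually P ?F"
    then have "eventually (\<lambda>t. \<not> P t) ?F" using ultra[of "\<lambda>n. P (g n)"] by (simp add: eventually_filtermap)
    then have "eventually (\<lambda>t. P t \<and> \<not> P t) (inf (nhds l) ?F)"
      using P unfolding eventually_inf by blast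
    then show False using l by (simp add: trivial_limit_def)
  qed
  then have "?F \<le> nhds l" by (rule filter_leI)
  then show ?thesis unfolding filterlim_def by blast
qed

lemma eventually_infinite:
  assumes "eventually P \<U>"
  shows "infinite {n. P n}"
proof
  assume "finite {n. P n}"
  then obtain k where "\<forall>n. P n \<longrightarrow> n < k" by (metis finite_nat_set_iff_bounded mem_Collect_eq)
  have "eventually (\<lambda>n. n \<ge> k) \<U>"
    using le_sequentially eventually_ge_at_top by (rule filter_leD)
  then have "eventually (\<lambda>n. False) \<U>" using assms
    by (rule eventually_elim2) (use \<open>\<forall>n. P n \<longrightarrow> n < k\<close> in \<open>auto simp: not_le[symmetric]\<close>)
  then show False using proper by (simp add: trivial_limit_def)
qed

text \<open>If no finite set works, an ultralimit of counterexamples is at least \<open>\<eta>\<close> on all of \<open>L\<close>.\<close>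

lemma weakly_null_finite_cover:
  fixes x :: "nat \<Rightarrow> 'a::real_normed_vector"
  assumes "weakly_null x" "infinite L" "0 < \<eta>"
  shows "\<exists>S. finite S \<and> S \<subseteq> L \<and>
    (\<forall>f :: 'a \<Rightarrow>\<^sub>L real. norm f \<le> 1 \<longrightarrow> (\<exists>n\<in>S. blinfun_apply f (x n) \<le> \<eta>))"
proof (rule ccontr)
  assume neg: "\<not> ?thesis"
  have "\<exists>f :: 'a \<Rightarrow>\<^sub>L real. norm f \<le> 1 \<and> (\<forall>n\<in>L \<inter> {..k}. blinfun_apply f (x n) \<ge> \<eta>)" for k
  proof (rule ccontr)
    assume "\<not> ?thesis"
    then have "\<forall>f :: 'a \<Rightarrow>\<^sub>L real. norm f \<le> 1 \<longrightarrow> (\<exists>n\<in>L \<inter> {..k}. blinfun_apply f (x n) \<le> \<eta>)"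
      by (meson not_le less_imp_le)
    then show False using neg by (meson finite_Int finite_atMost inf_le1)
  qed
  then obtain f :: "nat \<Rightarrow> 'a \<Rightarrow>\<^sub>L real"
    where f: "\<And>k. norm (f k) \<le> 1" "\<And>k n. n \<in> L \<Longrightarrow> n \<le> k \<Longrightarrow> blinfun_apply (f k) (x n) \<ge> \<eta>"
    by (metis IntI atMost_iff)
  have bound: "\<bar>blinfun_apply (f k) z\<bar> \<le> norm z" for k z
    using f(1) by (rule blinfun_apply_le_norm)
  \<comment> \<open>\<open>g\<close> is the pointwise ultralimit of the \<open>f k\<close>.
    Uniqueness of limits makes it linear and it inherits the norm bound, so weak nullity applies to
    it.\<close>
  define g where "g z = (SOME l. ((\<lambda>k. blinfun_apply (f k) z) \<longlongrightarrow> l) \<U>)" for z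
  have g: "((\<lambda>k. blinfun_apply (f k) z) \<longlongrightarrow> g z) \<U>" for z
    unfolding g_def by (rule someI_ex[OF bounded_convergent]) (rule bound)
  have "bounded_linear g"
  proof (rule bounded_linear_intro[where K = 1])
    show "g (z + w) = g z + g w" for z w
      using tendsto_unique[OF proper g[of "z + w"]] tendsto_add[OF g[of z] g[of w]]
      by (simp add: blinfun.add_right)
    show "g (c *\<^sub>R z) = c *\<^sub>R g z" for c z
      using tendsto_unique[OF proper g[of "c *\<^sub>R z"]] tendsto_mult_left[OF g[of z], of c]
      by (simp add: blinfun.scaleR_right)
    show "norm (g z) \<le> norm z * 1" for z
      using tendsto_upperbound[OF tendsto_rabs[OF g[of z]] _ proper, of "norm z"] bound[of _ z] by simp
  qed
  then have "(\<lambda>n. g (x n)) \<longlonglongrightarrow> 0"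
    using assms(1) unfolding weakly_null_def by (metis bounded_linear_Blinfun_apply)
  then have "eventually (\<lambda>n. g (x n) < \<eta>) sequentially" using assms(3) by (simp add: order_tendstoD)
  then obtain n where n: "n \<in> L" "g (x n) < \<eta>"
    using assms(2) unfolding eventually_sequentially infinite_nat_iff_unbounded_le by blast
  \<comment> \<open>For fixed \<open>n\<close> in \<open>L\<close> the lower bound holds for all
    \<open>k \<ge> n\<close>, hence survives in the ultralimit.\<close>
  have "eventually (\<lambda>k. \<eta> \<le> blinfun_apply (f k) (x n)) \<U>"
    using filter_leD[OF le_sequentially eventually_ge_at_top[of n]] f(2)[OF n(1)]
    by (rule eventually_mono)
  then have "\<eta> \<le> g (x n)" using tendsto_lowerbound[OF g _ proper] by blast
  then show False using n by simp
qed

end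

section \<open>A combinatorial selection principle\<close>

text \<open>The form that \<open>monos\<close> expects below, where \<open>avoids\<close> recurs
  under \<open>eventually\<close>.\<close>

lemma eventually_mono_imp: "(\<And>n. P n \<longrightarrow> Q n) \<Longrightarrow> eventually P F \<longrightarrow> eventually Q F"
  by (auto elim: eventually_mono)

text \<open>\<open>avoids \<U> A V Y\<close>: intersecting \<open>Y\<close> successively with sets \<open>A n\<close> for \<open>\<U>\<close>-generic indices
  \<open>n\<close> one reaches, after finitely many steps, a nonempty set disjoint from \<open>V\<close>.\<close>

inductive avoids :: "nat filter \<Rightarrow> (nat \<Rightarrow> 'f set) \<Rightarrow> 'f set \<Rightarrow> 'f set \<Rightarrow> bool"
  for \<U> A V where
  now: "Y \<noteq> {} \<Longrightarrow> Y \<inter> V = {} \<Longrightarrow> avoids \<U> A V Y"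
| later: "eventually (\<lambda>n. avoids \<U> A V (Y \<inter> A n)) \<U> \<Longrightarrow> avoids \<U> A V Y"
  monos eventually_mono_imp

text \<open>In the application \<open>K\<close> is the dual unit ball, \<open>A i n\<close> collects
  the functionals that are at least \<open>(1/2)^i\<close> at \<open>x n\<close>, and
  \<open>B k c n\<close> those obeying the one-sided bound of level \<open>k\<close> at
  \<open>x n\<close>, on the side given by \<open>c\<close>.\<close>

locale selection = nat_ultrafilter +
  fixes K :: "'f set" and A :: "nat \<Rightarrow> nat \<Rightarrow> 'f set" and B :: "nat \<Rightarrow> bool \<Rightarrow> nat \<Rightarrow> 'f set"
  assumes cover: "infinite L \<Longrightarrow> \<exists>S. finite S \<and> S \<subseteq> L \<and> K \<subseteq> (\<Union>n\<in>S. B k c n)"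
begin

section \<open>Generic avoidance against finite covers\<close>

lemma avoids_nonempty: "avoids \<U> a V Y \<Longrightarrow> Y \<noteq> {}"
proof (induction rule: avoids.induct)
  case (later Y)
  have "eventually (\<lambda>n. Y \<inter> a n \<noteq> {}) \<U>" using later by (rule eventually_mono) blast
  then show ?case using eventually_happens'[OF proper] by blast
qed

text \<open>Follow the generic intersections that make \<open>Y\<close> disjoint from one
  \<open>V j\<close>. The remaining sets then cover what is left, so induction on \<open>S\<close>
  makes it empty, whereas \<open>avoids\<close> reaches only nonempty sets. Allowing disjointness in
  the hypothesis makes it stable under these intersections, since \<open>Y \<inter> a n\<close> may
  be empty.\<close>

lemma avoids_cover_empty:
  assumes "finite S" "\<And>j. j \<in> S \<Longrightarrow> avoids \<U> a (V j) Y \<or> Y \<inter> V j = {}" "Y \<subseteq> (\<Union>j\<in>S. V j)"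
  shows "Y = {}"
  using assms
proof (induction S arbitrary: Y)
  case (insert j S)
  have main: "Y = {}" if "avoids \<U> a (V j) Y" "\<forall>i\<in>S. avoids \<U> a (V i) Y \<or> Y \<inter> V i = {}"
    "Y \<subseteq> V j \<union> (\<Union>i\<in>S. V i)" for Y
    using that
  proof (induction rule: avoids.induct)
    case (now Y)
    then show ?case using insert.IH[of Y] by blast
  next
    case (later Y)
    have "\<forall>i\<in>S. eventually (\<lambda>n. avoids \<U> a (V i) (Y \<inter> a n) \<or> (Y \<inter> a n) \<inter> V i = {}) \<U>"
    proof
      fix i assume "i \<in> S"
      with later.prems have "avoids \<U> a (V i) Y \<or> Y \<inter> V i = {}" by blast
      then show "eventually (\<lambda>n. avoids \<U> a (V i) (Y \<inter> a n) \<or> (Y \<inter> a n) \<inter> V i = {}) \<U>"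
      proof
        assume "avoids \<U> a (V i) Y"
        then show ?thesis
        proof cases
          case now
          then show ?thesis by (intro always_eventually) blast
        next
          case later
          then show ?thesis by (rule eventually_mono) blast
        qed
      next
        assume "Y \<inter> V i = {}"
        then show ?thesis by (intro always_eventually) blast
      qed
    qed
    then have "eventually (\<lambda>n. \<forall>i\<in>S. avoids \<U> a (V i) (Y \<inter> a n) \<or> (Y \<inter> a n) \<inter> V i = {}) \<U>"
      using insert.hyps(1) by (simp add: eventually_ball_finite)
    with later.IH have "eventually (\<lambda>n. Y \<inter> a n = {} \<and> avoids \<U> a (V j) (Y \<inter> a n)) \<U>"
    proof eventually_elim
      case (elim n)
      have "Y \<inter> a n \<subseteq> V j \<union> (\<Union>i\<in>S. V i)" using later.prems(2) by (rule le_infI1)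
      then have "Y \<inter> a n = {}" using elim by simp
      then show ?case using conjunct1[OF elim(1)] by (rule conjI)
    qed
    then obtain n where "Y \<inter> a n = {}" "avoids \<U> a (V j) (Y \<inter> a n)"
      using eventually_happens'[OF proper] by blast
    then show ?case using avoids_nonempty by blast
  qed
  show ?case
  proof (cases "avoids \<U> a (V j) Y")
    case True
    then show ?thesis using main insert.prems by simp
  next
    case False
    then have "Y \<inter> V j = {}" using insert.prems(1)[of j] by simp
    then have "Y \<subseteq> (\<Union>i\<in>S. V i)" using insert.prems(2) by blast
    then show ?thesis using insert.IH[of Y] insert.prems(1) by simp
  qed
qed simp

text \<open>Otherwise the indices \<open>n\<close> with \<open>avoids\<close> form an infinite set;
  by \<open>cover\<close>, finitely many of their sets \<open>B k c n\<close> cover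
  \<open>Y\<close>, and \<open>avoids_cover_empty\<close> applies.\<close>

lemma eventually_not_avoids_cover:
  assumes "Y \<subseteq> K" "Y \<noteq> {}"
  shows "eventually (\<lambda>n. \<not> avoids \<U> a (B k c n) Y) \<U>"
proof (rule ccontr)
  assume "\<not> ?thesis"
  then have "eventually (\<lambda>n. avoids \<U> a (B k c n) Y) \<U>"
    using ultra[of "\<lambda>n. avoids \<U> a (B k c n) Y"] by blast
  then obtain S where S: "finite S" "S \<subseteq> {n. avoids \<U> a (B k c n) Y}" "K \<subseteq> (\<Union>n\<in>S. B k c n)"
    using cover eventually_infinite by meson
  have "Y = {}"
    by (rule avoids_cover_empty[of S a "B k c"]) (use S assms in auto)
  then show False using assms by simp
qed

lemma eventually_not_avoids_Int:
  assumes "\<not> avoids \<U> a V Y"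
  shows "eventually (\<lambda>n. \<not> avoids \<U> a V (Y \<inter> a n)) \<U>"
  using assms ultra[of "\<lambda>n. avoids \<U> a V (Y \<inter> a n)"] avoids.later by blast

section \<open>Inductive choice of the subsequence\<close>

text \<open>Finite sequences are stored with the newest element first. A pair \<open>(V, Y)\<close> in \<open>tasks\<close> stands for
  the promise \<open>\<not> avoids \<U> (A i) V Y\<close>, to be preserved by all later choices.\<close>

primrec stems :: "nat \<Rightarrow> nat list \<Rightarrow> 'f set set" where
  "stems i [] = {K}"
| "stems i (n # ns) = stems i ns \<union> (\<lambda>Y. Y \<inter> A i n) ` stems i ns
     \<union> (\<Union>c. (\<lambda>Y. Y \<inter> B (length ns) c n) ` stems i ns)"

primrec tasks :: "nat \<Rightarrow> nat list \<Rightarrow> ('f set \<times> 'f set) set" where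
  "tasks i [] = {}"
| "tasks i (n # ns) = tasks i ns \<union> (\<lambda>(V, Y). (V, Y \<inter> A i n)) ` tasks i ns
     \<union> (\<Union>c. Pair (B (length ns) c n) ` stems i ns)"

lemma finite_stems: "finite (stems i ns)"
  by (induction ns) auto

lemma finite_tasks: "finite (tasks i ns)"
  by (induction ns) (auto simp: finite_stems)

lemma stems_subset: "Y \<in> stems i ns \<Longrightarrow> Y \<subseteq> K"
  by (induction ns arbitrary: Y) auto

lemma K_in_stems: "K \<in> stems i ns"
  by (induction ns) auto

text \<open>A stem records one decision for each index in \<open>ns\<close>: skip it, intersect with
  its \<open>A i\<close>, or intersect with one of its \<open>B\<close>. The new index
  \<open>n\<close>, which takes position \<open>length ns\<close>, must make its own promises true
  and preserve the old ones. Only the levels \<open>i \<le> length ns\<close> count, which leaves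
  finitely many conditions.\<close>

definition admissible :: "nat list \<Rightarrow> nat \<Rightarrow> bool" where
  "admissible ns n \<longleftrightarrow> (\<forall>j\<in>set ns. j < n) \<and>
    (\<forall>i\<le>length ns. (\<forall>Y\<in>stems i ns. \<forall>c. Y \<noteq> {} \<longrightarrow> \<not> avoids \<U> (A i) (B (length ns) c n) Y) \<and>
      (\<forall>(V, Y)\<in>tasks i ns. \<not> avoids \<U> (A i) V Y \<longrightarrow> \<not> avoids \<U> (A i) V (Y \<inter> A i n)))"

text \<open>Finitely many conditions, each true for \<open>\<U>\<close>-almost every
  \<open>n\<close>.\<close>

lemma ex_admissible: "\<exists>n. admissible ns n"
proof -
  have "eventually (\<lambda>n. j < n) \<U>" for j
    using le_sequentially eventually_gt_at_top by (rule filter_leD)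
  then have "eventually (\<lambda>n. \<forall>j\<in>set ns. j < n) \<U>"
    by (simp add: eventually_ball_finite)
  moreover have "eventually (\<lambda>n. Y \<noteq> {} \<longrightarrow> \<not> avoids \<U> (A i) (B (length ns) c n) Y) \<U>"
    if "Y \<in> stems i ns" for i Y c
    using eventually_not_avoids_cover[OF stems_subset[OF that]] by (cases "Y = {}") simp_all
  then have "eventually (\<lambda>n. \<forall>i\<in>{..length ns}. \<forall>Y\<in>stems i ns. \<forall>c\<in>UNIV.
      Y \<noteq> {} \<longrightarrow> \<not> avoids \<U> (A i) (B (length ns) c n) Y) \<U>"
    by (intro eventually_ball_finite ballI finite_stems finite_atMost finite)
  moreover have "eventually (\<lambda>n. \<not> avoids \<U> (A i) V Y \<longrightarrow> \<not> avoids \<U> (A i) V (Y \<inter> A i n)) \<U>"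
    for i V Y
    using eventually_not_avoids_Int[of "A i" V Y] by (cases "avoids \<U> (A i) V Y") simp_all
  then have "eventually (\<lambda>n. \<forall>i\<in>{..length ns}. \<forall>p\<in>tasks i ns.
      \<not> avoids \<U> (A i) (fst p) (snd p) \<longrightarrow> \<not> avoids \<U> (A i) (fst p) (snd p \<inter> A i n)) \<U>"
    by (intro eventually_ball_finite ballI finite_tasks finite_atMost)
  ultimately have "eventually (admissible ns) \<U>"
    by eventually_elim (simp add: admissible_def case_prod_beta)
  then show ?thesis using eventually_happens'[OF proper] by blast
qed

primrec prefix :: "nat \<Rightarrow> nat list" where
  "prefix 0 = []"
| "prefix (Suc k) = (SOME n. admissible (prefix k) n) # prefix k"

definition sel :: "nat \<Rightarrow> nat" where
  "sel k = (SOME n. admissible (prefix k) n)"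

lemma prefix_Suc: "prefix (Suc k) = sel k # prefix k"
  by (simp add: sel_def)

declare prefix.simps(2) [simp del]
declare prefix_Suc [simp]

lemma length_prefix [simp]: "length (prefix k) = k"
  by (induction k) auto

lemma admissible_sel: "admissible (prefix k) (sel k)"
  unfolding sel_def by (rule someI_ex[OF ex_admissible])

lemma strict_mono_sel: "strict_mono sel"
  unfolding strict_mono_Suc_iff
proof
  fix k
  show "sel k < sel (Suc k)" using admissible_sel[of "Suc k"] by (simp add: admissible_def)
qed

text \<open>Promises made when position \<open>k\<close> is filled survive all later intersections
  with sets \<open>A i (sel j)\<close>. Membership in \<open>tasks\<close> is carried along because
  \<open>admissible\<close> protects only the listed promises.\<close>

lemma not_avoids_later:
  assumes "i \<le> k" "Y \<in> stems i (prefix k)" "Y \<noteq> {}" "finite F" "F \<subseteq> {Suc k..<N}" "Suc k \<le> N"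
  shows "(B k c (sel k), Y \<inter> (\<Inter>j\<in>F. A i (sel j))) \<in> tasks i (prefix N) \<and>
    \<not> avoids \<U> (A i) (B k c (sel k)) (Y \<inter> (\<Inter>j\<in>F. A i (sel j)))"
  using assms(6,5,4)
proof (induction N arbitrary: F rule: dec_induct)
  case base
  then have "F = {}" by auto
  then show ?case using admissible_sel[of k] assms(1-3) by (auto simp: admissible_def)
next
  case (step N)
  show ?case
  proof (cases "N \<in> F")
    case False
    then have "F \<subseteq> {Suc k..<N}" using step.prems by (auto simp: less_Suc_eq)
    then show ?thesis using step.IH[of F] step.prems by auto
  next
    case True
    let ?Y = "Y \<inter> (\<Inter>j\<in>F - {N}. A i (sel j))"
    have eq: "Y \<inter> (\<Inter>j\<in>F. A i (sel j)) = ?Y \<inter> A i (sel N)" using True by blast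
    have "F - {N} \<subseteq> {Suc k..<N}" using step.prems by (auto simp: less_Suc_eq)
    then have IH: "(B k c (sel k), ?Y) \<in> tasks i (prefix N)" "\<not> avoids \<U> (A i) (B k c (sel k)) ?Y"
      using step.IH[of "F - {N}"] step.prems by auto
    have "i \<le> N" using assms(1) step.hyps by simp
    then have "\<not> avoids \<U> (A i) (B k c (sel k)) (?Y \<inter> A i (sel N))"
      using admissible_sel[of N] IH unfolding admissible_def by fastforce
    then show ?thesis using IH(1) unfolding eq by force
  qed
qed

text \<open>Positions from \<open>i\<close> on are decided one at a time by shrinking the stem:
  intersect with \<open>A\<close> on \<open>F\<close> and with \<open>B\<close> off
  \<open>F\<close>. The stem must keep meeting the sets \<open>A i (sel j)\<close> still to come,
  which the promises secure.\<close>

lemma selection_step: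
  assumes F: "finite F" and ne: "K \<inter> (\<Inter>j\<in>F. A i (sel j)) \<noteq> {}" and "F \<subseteq> {i..}" "i \<le> k"
  shows "\<exists>Y\<in>stems i (prefix k). Y \<inter> (\<Inter>j\<in>{j\<in>F. k \<le> j}. A i (sel j)) \<noteq> {} \<and>
    Y \<subseteq> (\<Inter>j\<in>{j\<in>F. j < k}. A i (sel j)) \<inter> (\<Inter>j\<in>{i..<k} - F. B j (c j) (sel j))"
  using assms(4)
proof (induction k rule: dec_induct)
  case base
  have "{j \<in> F. i \<le> j} = F" "{j \<in> F. j < i} = {}" using assms(3) by auto
  then show ?case using K_in_stems ne by (intro bexI[of _ K]) auto
next
  case (step k)
  then obtain Y where Y: "Y \<in> stems i (prefix k)" "Y \<inter> (\<Inter>j\<in>{j\<in>F. k \<le> j}. A i (sel j)) \<noteq> {}"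
    and sub: "Y \<subseteq> (\<Inter>j\<in>{j\<in>F. j < k}. A i (sel j)) \<inter> (\<Inter>j\<in>{i..<k} - F. B j (c j) (sel j))"
    by blast
  show ?case
  proof (cases "k \<in> F")
    case True
    have "Y \<inter> A i (sel k) \<in> stems i (prefix (Suc k))" using Y by auto
    moreover have "(Y \<inter> A i (sel k)) \<inter> (\<Inter>j\<in>{j\<in>F. Suc k \<le> j}. A i (sel j)) \<noteq> {}"
      using Y(2) True by fastforce
    moreover have "{i..<Suc k} - F = {i..<k} - F" "{j \<in> F. j < Suc k} = insert k {j \<in> F. j < k}"
      using True by (auto simp: less_Suc_eq)
    then have "Y \<inter> A i (sel k) \<subseteq> (\<Inter>j\<in>{j\<in>F. j < Suc k}. A i (sel j))
        \<inter> (\<Inter>j\<in>{i..<Suc k} - F. B j (c j) (sel j))"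
      using sub by auto
    ultimately show ?thesis by (intro bexI[of _ "Y \<inter> A i (sel k)"] conjI)
  next
    case False
    let ?F = "{j\<in>F. Suc k \<le> j}"
    obtain N where N: "\<forall>j\<in>F. j < N" using F finite_nat_set_iff_bounded by blast
    have "\<not> avoids \<U> (A i) (B k (c k) (sel k)) (Y \<inter> (\<Inter>j\<in>?F. A i (sel j)))"
    proof (rule conjunct2[OF not_avoids_later[where N = "max N (Suc k)"]])
      show "?F \<subseteq> {Suc k..<max N (Suc k)}" using N by auto
    qed (use Y step.hyps F in auto)
    moreover have "?F = {j\<in>F. k \<le> j}" using False by (auto simp: Suc_le_eq order_less_le)
    \<comment> \<open>Were this intersection disjoint from \<open>B k (c k) (sel k)\<close>, rule
      \<open>now\<close> would give \<open>avoids\<close>, against the promise.\<close>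
    ultimately have "Y \<inter> (\<Inter>j\<in>?F. A i (sel j)) \<inter> B k (c k) (sel k) \<noteq> {}"
      using avoids.now[of "Y \<inter> (\<Inter>j\<in>?F. A i (sel j))"] Y(2) by auto
    moreover have "Y \<inter> B k (c k) (sel k) \<in> stems i (prefix (Suc k))" using Y by auto
    moreover have "{i..<Suc k} - F = insert k ({i..<k} - F)" "{j \<in> F. j < Suc k} = {j \<in> F. j < k}"
      using False step.hyps by (auto simp: less_Suc_eq)
    then have "Y \<inter> B k (c k) (sel k) \<subseteq> (\<Inter>j\<in>{j\<in>F. j < Suc k}. A i (sel j))
        \<inter> (\<Inter>j\<in>{i..<Suc k} - F. B j (c j) (sel j))"
      using sub by auto
    ultimately show ?thesis by (intro bexI[of _ "Y \<inter> B k (c k) (sel k)"]) (simp_all add: Int_ac)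
  qed
qed

text \<open>At stage \<open>N\<close> every position has been decided, so any element of the final
  stem serves as \<open>g\<close>.\<close>

lemma selection:
  assumes "F \<subseteq> {i..<N}" "\<exists>f\<in>K. \<forall>j\<in>F. f \<in> A i (sel j)"
  shows "\<exists>g\<in>K. (\<forall>j\<in>F. g \<in> A i (sel j)) \<and> (\<forall>j\<in>{i..<N} - F. g \<in> B j (c j) (sel j))"
proof (cases "i \<le> N")
  case True
  have F: "finite F" "F \<subseteq> {i..}" using assms(1) finite_subset by auto
  have "K \<inter> (\<Inter>j\<in>F. A i (sel j)) \<noteq> {}" using assms(2) by blast
  from selection_step[OF F(1) this F(2) True, of c]
  obtain Y where Y: "Y \<in> stems i (prefix N)" "Y \<noteq> {}"
    "Y \<subseteq> (\<Inter>j\<in>{j\<in>F. j < N}. A i (sel j)) \<inter> (\<Inter>j\<in>{i..<N} - F. B j (c j) (sel j))"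
    by blast
  moreover have "{j\<in>F. j < N} = F" using assms(1) by auto
  ultimately obtain g where "g \<in> Y" "Y \<subseteq> (\<Inter>j\<in>F. A i (sel j)) \<inter> (\<Inter>j\<in>{i..<N} - F. B j (c j) (sel j))"
    by (metis ex_in_conv)
  then show ?thesis using stems_subset[OF Y(1)] by (intro bexI[of _ g]) auto
next
  case False
  then show ?thesis using assms by auto
qed

end

section \<open>Unconditionality from one-sided suppression\<close>

text \<open>This is the conclusion of \<open>selection\<close> for functionals. The side
  \<open>c j\<close> is free for each \<open>j\<close>, and the tolerances
  \<open>(1/4)^j / 8\<close> have total \<open>1/6\<close>.\<close>

locale one_sided_suppression =
  fixes y :: "nat \<Rightarrow> 'a::real_normed_vector"
  assumes norm_y: "norm (y n) = 1"
    and suppress: "\<lbrakk>F \<subseteq> {i..<N}; norm (f :: 'a \<Rightarrow>\<^sub>L real) \<le> 1; \<forall>j\<in>F. (1/2)^i \<le> blinfun_apply f (y j)\<rbrakk> \<Longrightarrow>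
      \<exists>g :: 'a \<Rightarrow>\<^sub>L real. norm g \<le> 1 \<and> (\<forall>j\<in>F. (1/2)^i \<le> blinfun_apply g (y j)) \<and>
        (\<forall>j\<in>{i..<N} - F. if c j then - ((1/4)^j / 8) \<le> blinfun_apply g (y j)
          else blinfun_apply g (y j) \<le> (1/4)^j / 8)"
begin

text \<open>Let \<open>c j\<close> follow the sign of \<open>b j\<close>. A term outside
  \<open>F\<close> then contributes at least minus its tolerance times
  \<open>\<bar>b j\<bar>\<close> to the value of \<open>g\<close> at the sum, and this value is at
  most the norm.\<close>

lemma norm_sum_ge:
  fixes b :: "nat \<Rightarrow> real" and f :: "'a \<Rightarrow>\<^sub>L real"
  assumes F: "F \<subseteq> {i..<N}" and b: "\<And>j. j \<in> F \<Longrightarrow> 0 \<le> b j"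
    and f: "norm f \<le> 1" "\<And>j. j \<in> F \<Longrightarrow> (1/2)^i \<le> blinfun_apply f (y j)"
  shows "(1/2)^i * (\<Sum>j\<in>F. b j) - (\<Sum>j=i..<N. \<bar>b j\<bar> * ((1/4)^j / 8)) \<le> norm (\<Sum>j=i..<N. b j *\<^sub>R y j)"
proof -
  obtain g :: "'a \<Rightarrow>\<^sub>L real" where g: "norm g \<le> 1" "\<forall>j\<in>F. (1/2)^i \<le> blinfun_apply g (y j)"
    "\<forall>j\<in>{i..<N} - F. if 0 \<le> b j then - ((1/4)^j / 8) \<le> blinfun_apply g (y j)
      else blinfun_apply g (y j) \<le> (1/4)^j / 8"
    using suppress[OF F f(1), of "\<lambda>j. 0 \<le> b j"] f(2) by blast
  have 1: "(1/2)^i * (\<Sum>j\<in>F. b j) \<le> (\<Sum>j\<in>F. b j * blinfun_apply g (y j))"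
    unfolding sum_distrib_left
  proof (rule sum_mono)
    fix j assume "j \<in> F"
    then show "(1/2)^i * b j \<le> b j * blinfun_apply g (y j)"
      using mult_left_mono[of "(1/2)^i" "blinfun_apply g (y j)" "b j"] b g(2) by (simp add: mult.commute)
  qed
  have "- (\<Sum>j\<in>{i..<N} - F. \<bar>b j\<bar> * ((1/4)^j / 8)) \<le> (\<Sum>j\<in>{i..<N} - F. b j * blinfun_apply g (y j))"
    unfolding sum_negf[symmetric]
  proof (rule sum_mono)
    fix j assume j: "j \<in> {i..<N} - F"
    show "- (\<bar>b j\<bar> * ((1/4)^j / 8)) \<le> b j * blinfun_apply g (y j)"
    proof (cases "0 \<le> b j")
      case True
      then have "- ((1/4)^j / 8) \<le> blinfun_apply g (y j)" using bspec[OF g(3) j] True by (simp only: if_True)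
      then show ?thesis using mult_left_mono[OF _ True] True by fastforce
    next
      case False
      then have "blinfun_apply g (y j) \<le> (1/4)^j / 8" using bspec[OF g(3) j] False by (simp only: if_False)
      then have "b j * ((1/4)^j / 8) \<le> b j * blinfun_apply g (y j)"
        using False by (intro mult_left_mono_neg) auto
      then show ?thesis using False by simp
    qed
  qed
  moreover have "(\<Sum>j\<in>{i..<N} - F. \<bar>b j\<bar> * ((1/4)^j / 8)) \<le> (\<Sum>j=i..<N. \<bar>b j\<bar> * ((1/4)^j / 8))"
    by (rule sum_mono2) auto
  ultimately have "(1/2)^i * (\<Sum>j\<in>F. b j) - (\<Sum>j=i..<N. \<bar>b j\<bar> * ((1/4)^j / 8))
      \<le> (\<Sum>j\<in>F. b j * blinfun_apply g (y j)) + (\<Sum>j\<in>{i..<N} - F. b j * blinfun_apply g (y j))"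
    using 1 by linarith
  also have "\<dots> = (\<Sum>j=i..<N. b j * blinfun_apply g (y j))"
    using sum.subset_diff[OF F, of "\<lambda>j. b j * blinfun_apply g (y j)"] by simp
  also have "\<dots> = blinfun_apply g (\<Sum>j=i..<N. b j *\<^sub>R y j)"
    by (simp add: blinfun.sum_right blinfun.scaleR_right)
  also have "\<dots> \<le> norm (\<Sum>j=i..<N. b j *\<^sub>R y j)"
    using blinfun_apply_le_norm[OF g(1)] by (meson abs_le_D1)
  finally show ?thesis .
qed

lemma norm_sum_sign:
  fixes b :: "nat \<Rightarrow> real"
  assumes "\<bar>s\<bar> = 1"
  shows "norm (\<Sum>j\<in>J. (s * b j) *\<^sub>R y j) = norm (\<Sum>j\<in>J. b j *\<^sub>R y j)"
proof -
  have "(\<Sum>j\<in>J. (s * b j) *\<^sub>R y j) = s *\<^sub>R (\<Sum>j\<in>J. b j *\<^sub>R y j)" by (simp add: scaleR_sum_right)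
  then show ?thesis using assms by simp
qed

text \<open>Apply \<open>norm_sum_ge\<close> with \<open>i = 0\<close> and \<open>F\<close> the
  position \<open>m\<close> of a largest coefficient. The threshold is then 1, attained by a
  functional norming \<open>y m\<close>, and the errors total at most
  \<open>\<bar>b m\<bar> / 2\<close>.\<close>

lemma coefficient_le_norm:
  fixes b :: "nat \<Rightarrow> real"
  assumes "n < N"
  shows "\<bar>b n\<bar> \<le> 2 * norm (\<Sum>j<N. b j *\<^sub>R y j)"
proof -
  obtain m where m: "m < N" and max: "\<And>j. j < N \<Longrightarrow> \<bar>b j\<bar> \<le> \<bar>b m\<bar>"
  proof -
    let ?M = "Max ((\<lambda>j. \<bar>b j\<bar>) ` {..<N})"
    have "?M \<in> (\<lambda>j. \<bar>b j\<bar>) ` {..<N}" by (rule Max_in) (use assms in auto)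
    then obtain m where "m < N" "?M = \<bar>b m\<bar>" by auto
    moreover have "\<bar>b j\<bar> \<le> ?M" if "j < N" for j using that by (intro Max_ge) auto
    ultimately show ?thesis using that by auto
  qed
  define s where "s = (if 0 \<le> b m then 1 else - 1 :: real)"
  have s: "\<bar>s\<bar> = 1" "s * b m = \<bar>b m\<bar>" unfolding s_def by auto
  obtain f :: "'a \<Rightarrow>\<^sub>L real" where f: "norm f \<le> 1" "blinfun_apply f (y m) = 1"
    using norming_functional[of "y m"] norm_y by auto
  have "(1/2)^0 * (\<Sum>j\<in>{m}. s * b j) - (\<Sum>j=0..<N. \<bar>s * b j\<bar> * ((1/4)^j / 8))
      \<le> norm (\<Sum>j=0..<N. (s * b j) *\<^sub>R y j)"
    by (rule norm_sum_ge[where f = f]) (use m f s in auto)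
  then have "\<bar>b m\<bar> - (\<Sum>j<N. \<bar>b j\<bar> * ((1/4)^j / 8)) \<le> norm (\<Sum>j<N. b j *\<^sub>R y j)"
    unfolding norm_sum_sign[OF s(1)] using s by (simp add: abs_mult lessThan_atLeast0)
  moreover have "(\<Sum>j<N. \<bar>b j\<bar> * ((1/4)^j / 8)) \<le> \<bar>b m\<bar> / 2"
  proof -
    have "(\<Sum>j<N. \<bar>b j\<bar> * ((1/4)^j / 8)) \<le> (\<Sum>j<N. \<bar>b m\<bar> * ((1/4)^j / 8))"
      by (intro sum_mono mult_right_mono max) auto
    also have "\<dots> = \<bar>b m\<bar> / 8 * (\<Sum>j<N. (1/4)^j)" by (simp add: sum_distrib_left)
    also have "(\<Sum>j<N. (1/4::real)^j) = (4/3) * (1 - (1/4)^N)" by (simp add: sum_gp_strict)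
    also have "\<bar>b m\<bar> / 8 * \<dots> \<le> \<bar>b m\<bar> / 8 * ((4/3) * 1)"
      by (intro mult_left_mono) auto
    finally show ?thesis by simp
  qed
  ultimately show ?thesis using max[OF assms] by linarith
qed

text \<open>The set \<open>P\<close> where a norming functional of the \<open>a\<close>-sum is large
  carries weight at least \<open>\<delta> = (1/2)^i\<close>. Weight at least
  \<open>\<delta> / 4\<close> sits where the functional and \<open>b\<close> have constant signs;
  there \<open>norm_sum_ge\<close> gives \<open>\<delta> * \<delta> / 4\<close> minus errors of at
  most \<open>\<delta> * \<delta> / 8\<close>.\<close>

lemma tail_unconditional:
  fixes a b :: "nat \<Rightarrow> real"
  assumes ab: "\<And>n. \<bar>b n\<bar> = \<bar>a n\<bar>" and a: "(\<Sum>j=i..<N. \<bar>a j\<bar>) \<le> 1"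
    and large: "2 * (1/2)^i \<le> norm (\<Sum>j=i..<N. a j *\<^sub>R y j)"
  shows "(1/4)^i / 8 \<le> norm (\<Sum>j=i..<N. b j *\<^sub>R y j)"
proof -
  define \<delta> :: real where "\<delta> = (1/2)^i"
  have "0 < \<delta>" unfolding \<delta>_def by simp
  have sq: "(1/4)^i = \<delta> * \<delta>" unfolding \<delta>_def by (simp flip: power_mult_distrib)
  obtain f :: "'a \<Rightarrow>\<^sub>L real" where f: "norm f \<le> 1"
    "blinfun_apply f (\<Sum>j=i..<N. a j *\<^sub>R y j) = norm (\<Sum>j=i..<N. a j *\<^sub>R y j)"
    using norming_functional by blast
  define P where "P = {j\<in>{i..<N}. \<delta> \<le> \<bar>blinfun_apply f (y j)\<bar>}"
  have "2 * \<delta> \<le> (\<Sum>j=i..<N. a j * blinfun_apply f (y j))"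
    using large f(2) unfolding \<delta>_def by (simp add: blinfun.sum_right blinfun.scaleR_right)
  \<comment> \<open>Off \<open>P\<close> each term is at most
    \<open>\<delta> * \<bar>a j\<bar>\<close>, and the weights sum to at most 1, so \<open>P\<close>
    accounts for at least \<open>2 * \<delta> - \<delta>\<close>.\<close>
  also have "\<dots> \<le> (\<Sum>j=i..<N. (if j \<in> P then \<bar>a j\<bar> else 0) + \<delta> * \<bar>a j\<bar>)"
  proof (rule sum_mono)
    fix j assume j: "j \<in> {i..<N}"
    have "a j * blinfun_apply f (y j) \<le> \<bar>a j\<bar> * \<bar>blinfun_apply f (y j)\<bar>"
      by (metis abs_ge_self abs_mult)
    also have "\<dots> \<le> (if j \<in> P then \<bar>a j\<bar> else 0) + \<delta> * \<bar>a j\<bar>"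
    proof (cases "j \<in> P")
      case True
      have "\<bar>a j\<bar> * \<bar>blinfun_apply f (y j)\<bar> \<le> \<bar>a j\<bar> * 1"
        using blinfun_apply_le_norm[OF f(1), of "y j"] norm_y by (intro mult_left_mono) auto
      then show ?thesis using True \<open>0 < \<delta>\<close> by (simp add: add_increasing2)
    next
      case False
      then have "\<bar>blinfun_apply f (y j)\<bar> \<le> \<delta>" using j unfolding P_def by auto
      then have "\<bar>a j\<bar> * \<bar>blinfun_apply f (y j)\<bar> \<le> \<bar>a j\<bar> * \<delta>" by (rule mult_left_mono) simp
      then show ?thesis using False by (simp add: mult.commute)
    qed
    finally show "a j * blinfun_apply f (y j) \<le> (if j \<in> P then \<bar>a j\<bar> else 0) + \<delta> * \<bar>a j\<bar>" .
  qed
  also have "\<dots> = (\<Sum>j\<in>P. \<bar>a j\<bar>) + \<delta> * (\<Sum>j=i..<N. \<bar>a j\<bar>)"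
  proof -
    have "(\<Sum>j=i..<N. if j \<in> P then \<bar>a j\<bar> else 0) = (\<Sum>j\<in>{i..<N} \<inter> P. \<bar>a j\<bar>)"
      by (simp add: sum.inter_restrict)
    moreover have "{i..<N} \<inter> P = P" unfolding P_def by blast
    ultimately show ?thesis by (simp add: sum.distrib sum_distrib_left)
  qed
  also have "\<dots> \<le> (\<Sum>j\<in>P. \<bar>a j\<bar>) + \<delta> * 1"
    using a \<open>0 < \<delta>\<close> by simp
  finally have P: "\<delta> \<le> (\<Sum>j\<in>P. \<bar>b j\<bar>)" using ab by simp
  define Q where "Q s t = {j\<in>P. \<delta> \<le> s * blinfun_apply f (y j) \<and> 0 \<le> t * b j}" for s t
  have fin: "finite (Q s t)" for s t unfolding Q_def P_def by simp
  \<comment> \<open>The four classes overlap where \<open>b j = 0\<close>, so a bound for unions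
    replaces a partition.\<close>
  have Un: "(\<Sum>j\<in>S \<union> T. \<bar>b j\<bar>) \<le> (\<Sum>j\<in>S. \<bar>b j\<bar>) + (\<Sum>j\<in>T. \<bar>b j\<bar>)"
    if "finite S" "finite T" for S T
  proof -
    have "0 \<le> (\<Sum>j\<in>S \<inter> T. \<bar>b j\<bar>)" by (rule sum_nonneg) simp
    then show ?thesis using sum.union_inter[OF that, of "\<lambda>j. \<bar>b j\<bar>"] by linarith
  qed
  have "(\<Sum>j\<in>P. \<bar>b j\<bar>) \<le> (\<Sum>j\<in>(Q 1 1 \<union> Q 1 (-1)) \<union> (Q (-1) 1 \<union> Q (-1) (-1)). \<bar>b j\<bar>)"
    by (rule sum_mono2) (auto simp: fin, auto simp: Q_def P_def)
  also have "\<dots> \<le> (\<Sum>j\<in>Q 1 1. \<bar>b j\<bar>) + (\<Sum>j\<in>Q 1 (-1). \<bar>b j\<bar>)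
      + ((\<Sum>j\<in>Q (-1) 1. \<bar>b j\<bar>) + (\<Sum>j\<in>Q (-1) (-1). \<bar>b j\<bar>))"
    by (intro order.trans[OF Un] add_mono Un finite_UnI fin)
  finally have four: "\<delta> \<le> (\<Sum>j\<in>Q 1 1. \<bar>b j\<bar>) + (\<Sum>j\<in>Q 1 (-1). \<bar>b j\<bar>)
      + ((\<Sum>j\<in>Q (-1) 1. \<bar>b j\<bar>) + (\<Sum>j\<in>Q (-1) (-1). \<bar>b j\<bar>))" using P by linarith
  have "\<exists>s t. \<bar>s\<bar> = 1 \<and> \<bar>t\<bar> = 1 \<and> \<delta> / 4 \<le> (\<Sum>j\<in>Q s t. \<bar>b j\<bar>)"
  proof (rule ccontr)
    assume "\<not> ?thesis"
    then have "(\<Sum>j\<in>Q s t. \<bar>b j\<bar>) < \<delta> / 4" if "\<bar>s\<bar> = 1" "\<bar>t\<bar> = 1" for s t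
      using that by (meson not_le)
    from this[of 1 1] this[of 1 "- 1"] this[of "- 1" 1] this[of "- 1" "- 1"] four show False by simp
  qed
  then obtain s t where st: "\<bar>s\<bar> = 1" "\<bar>t\<bar> = 1" "\<delta> / 4 \<le> (\<Sum>j\<in>Q s t. \<bar>b j\<bar>)" by blast
  have "(1/2)^i * (\<Sum>j\<in>Q s t. t * b j) - (\<Sum>j=i..<N. \<bar>t * b j\<bar> * ((1/4)^j / 8))
      \<le> norm (\<Sum>j=i..<N. (t * b j) *\<^sub>R y j)"
    by (rule norm_sum_ge[where f = "s *\<^sub>R f"])
      (use f st in \<open>auto simp: Q_def P_def \<delta>_def blinfun.scaleR_left\<close>)
  moreover have "(\<Sum>j\<in>Q s t. t * b j) = (\<Sum>j\<in>Q s t. \<bar>b j\<bar>)"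
  proof (rule sum.cong)
    fix j assume "j \<in> Q s t"
    then have "t * b j = \<bar>t * b j\<bar>" unfolding Q_def by simp
    then show "t * b j = \<bar>b j\<bar>" using st(2) by (simp add: abs_mult)
  qed simp
  moreover have "\<delta> * (\<delta> / 4) \<le> \<delta> * (\<Sum>j\<in>Q s t. \<bar>b j\<bar>)"
    using st(3) \<open>0 < \<delta>\<close> by (intro mult_left_mono) auto
  \<comment> \<open>Every \<open>j\<close> here is at least \<open>i\<close>, so its tolerance is at
    most \<open>\<delta> * \<delta> / 8\<close>.\<close>
  moreover have "(\<Sum>j=i..<N. \<bar>t * b j\<bar> * ((1/4)^j / 8)) \<le> (\<Sum>j=i..<N. \<bar>a j\<bar> * (\<delta> * \<delta> / 8))"
  proof (rule sum_mono)
    fix j assume "j \<in> {i..<N}"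
    then have "(1/4)^j \<le> \<delta> * \<delta>" unfolding sq[symmetric] by (intro power_decreasing) auto
    then show "\<bar>t * b j\<bar> * ((1/4)^j / 8) \<le> \<bar>a j\<bar> * (\<delta> * \<delta> / 8)"
      using st(2) ab by (simp add: abs_mult mult_left_mono)
  qed
  moreover have "(\<Sum>j=i..<N. \<bar>a j\<bar> * (\<delta> * \<delta> / 8)) \<le> 1 * (\<delta> * \<delta> / 8)"
    unfolding sum_distrib_right[symmetric] using a by (rule mult_right_mono) simp
  ultimately show ?thesis unfolding norm_sum_sign[OF st(2)] sq \<delta>_def[symmetric] by simp
qed

text \<open>Either the first \<open>i\<close> coefficients are negligible and the tail estimate applies, or one of them
  is large and bounds the norm from below, irrespective of signs.\<close>

lemma finite_sum_unconditional:
  fixes a b :: "nat \<Rightarrow> real"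
  assumes ab: "\<And>n. \<bar>b n\<bar> = \<bar>a n\<bar>" and a: "(\<Sum>j<N. \<bar>a j\<bar>) \<le> 1" and "i \<le> N"
    and large: "4 * (1/2)^i \<le> norm (\<Sum>j<N. a j *\<^sub>R y j)"
  shows "(1/4)^i / (32 * (real i + 1)) \<le> norm (\<Sum>j<N. b j *\<^sub>R y j)"
proof -
  have split: "(\<Sum>j<N. h j) = (\<Sum>j<i. h j) + (\<Sum>j=i..<N. h j)" for h :: "nat \<Rightarrow> 'c::comm_monoid_add"
    using sum.atLeastLessThan_concat[of 0 i N h] \<open>i \<le> N\<close> by (simp add: lessThan_atLeast0)
  have head: "norm (\<Sum>j<i. h j *\<^sub>R y j) \<le> (\<Sum>j<i. \<bar>h j\<bar>)" for h :: "nat \<Rightarrow> real"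
    by (rule order.trans[OF norm_sum]) (simp add: norm_y)
  define \<kappa> :: real where "\<kappa> = (1/4)^i / 8"
  have "0 < \<kappa>" unfolding \<kappa>_def by simp
  have "8 * \<kappa> \<le> (1/2)^i" unfolding \<kappa>_def by (simp add: power_mono)
  then have \<kappa>: "\<kappa> \<le> (1/2)^i" using \<open>0 < \<kappa>\<close> by linarith
  have "\<kappa> / (4 * (real i + 1)) \<le> norm (\<Sum>j<N. b j *\<^sub>R y j)"
  \<comment> \<open>The threshold \<open>\<kappa> / 2\<close> leaves \<open>\<kappa> / 2\<close>
    after the head is subtracted from the bound \<open>\<kappa>\<close> of
    \<open>tail_unconditional\<close>.\<close>
  proof (cases "(\<Sum>j<i. \<bar>a j\<bar>) < \<kappa> / 2")
    case True
    have "norm (\<Sum>j<N. a j *\<^sub>R y j) \<le> (\<Sum>j<i. \<bar>a j\<bar>) + norm (\<Sum>j=i..<N. a j *\<^sub>R y j)"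
      unfolding split[of "\<lambda>j. a j *\<^sub>R y j"] using head norm_triangle_ineq
      by (meson add_right_mono order.trans)
    then have "2 * (1/2)^i \<le> norm (\<Sum>j=i..<N. a j *\<^sub>R y j)"
      using large True \<kappa> \<open>0 < \<kappa>\<close> by linarith
    moreover have "0 \<le> (\<Sum>j<i. \<bar>a j\<bar>)" by (rule sum_nonneg) simp
    then have "(\<Sum>j=i..<N. \<bar>a j\<bar>) \<le> 1"
      using a split[of "\<lambda>j. \<bar>a j\<bar>"] by linarith
    ultimately have "\<kappa> \<le> norm (\<Sum>j=i..<N. b j *\<^sub>R y j)"
      unfolding \<kappa>_def using tail_unconditional[of b a] ab by blast
    moreover have "norm (\<Sum>j=i..<N. b j *\<^sub>R y j) \<le> (\<Sum>j<i. \<bar>b j\<bar>) + norm (\<Sum>j<N. b j *\<^sub>R y j)"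
      using head[of b] norm_triangle_ineq4[of "\<Sum>j<N. b j *\<^sub>R y j" "\<Sum>j<i. b j *\<^sub>R y j"]
      unfolding split[of "\<lambda>j. b j *\<^sub>R y j"] by simp
    ultimately have "\<kappa> / 2 \<le> norm (\<Sum>j<N. b j *\<^sub>R y j)" using True ab by simp
    moreover have "\<kappa> / (4 * (real i + 1)) \<le> \<kappa> / 2"
      using \<open>0 < \<kappa>\<close> by (intro divide_left_mono) auto
    ultimately show ?thesis by linarith
  next
    case False
    let ?c = "2 * norm (\<Sum>j<N. b j *\<^sub>R y j)"
    have "\<kappa> / 2 \<le> (\<Sum>j<i. \<bar>b j\<bar>)" using False ab by simp
    also have "\<dots> \<le> (\<Sum>j<i. ?c)"
      by (rule sum_mono) (use \<open>i \<le> N\<close> in \<open>auto intro!: coefficient_le_norm\<close>)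
    \<comment> \<open>The factor \<open>real i + 1\<close> in place of \<open>real i\<close> keeps
      the divisor nonzero.\<close>
    also have "\<dots> \<le> (real i + 1) * ?c" by (simp add: mult_right_mono)
    finally show ?thesis by (simp add: field_simps)
  qed
  then show ?thesis unfolding \<kappa>_def by simp
qed

end

text \<open>The bound for partial sums depends only on \<open>i\<close>, hence only on
  \<open>\<delta>\<close>, so it passes to the limit.\<close>

lemma convexly_unconditional_of_suppression:
  fixes y :: "nat \<Rightarrow> 'a::banach"
  assumes "one_sided_suppression y"
  shows "convexly_unconditional y"
proof -
  interpret one_sided_suppression y by fact
  show ?thesis unfolding convexly_unconditional_def
  proof (intro conjI allI impI)
    show "normalized y" unfolding normalized_def using norm_y by blast
    fix \<delta> :: real assume "0 < \<delta>"
    then obtain i where "(1/2)^i < \<delta> / 4" using real_arch_pow_inv[of "\<delta> / 4" "1/2"] by auto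
    then have i: "4 * (1/2)^i < \<delta>" by simp
    define C :: real where "C = (1/4)^i / (32 * (real i + 1))"
    have "0 < C" unfolding C_def by simp
    \<comment> \<open>The limit yields only the weak inequality with \<open>C\<close>; halving
      \<open>C\<close> makes it strict.\<close>
    have "norm (\<Sum>n. (\<epsilon> n * a n) *\<^sub>R y n) > C / 2"
      if a: "summable (\<lambda>n. \<bar>a n\<bar>)" "(\<Sum>n. \<bar>a n\<bar>) \<le> 1" "\<delta> < norm (\<Sum>n. a n *\<^sub>R y n)"
        and \<epsilon>: "\<forall>n. \<epsilon> n \<in> {-1, 1}" for a \<epsilon> :: "nat \<Rightarrow> real"
    proof -
      have abs: "\<bar>\<epsilon> n * a n\<bar> = \<bar>a n\<bar>" for n using spec[OF \<epsilon>, of n] by auto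
      have lim: "(\<lambda>N. norm (\<Sum>n<N. b n *\<^sub>R y n)) \<longlonglongrightarrow> norm (\<Sum>n. b n *\<^sub>R y n)"
        if "\<And>n. \<bar>b n\<bar> = \<bar>a n\<bar>" for b
        by (rule tendsto_norm, rule summable_LIMSEQ, rule summable_norm_cancel)
          (simp add: norm_y that a(1))
      have "eventually (\<lambda>N. \<delta> < norm (\<Sum>n<N. a n *\<^sub>R y n)) sequentially"
        using order_tendstoD(1)[OF lim a(3)] by simp
      then have "eventually (\<lambda>N. C \<le> norm (\<Sum>n<N. (\<epsilon> n * a n) *\<^sub>R y n)) sequentially"
        using eventually_ge_at_top[of i]
      proof eventually_elim
        case (elim N)
        have "(\<Sum>j<N. \<bar>a j\<bar>) \<le> 1"
          using sum_le_suminf[OF a(1), of "{..<N}"] a(2) by simp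
        then show ?case unfolding C_def
          by (intro finite_sum_unconditional[where a = a]) (use abs elim i in auto)
      qed
      then have "C \<le> norm (\<Sum>n. (\<epsilon> n * a n) *\<^sub>R y n)"
        by (rule tendsto_lowerbound[OF lim[OF abs]]) simp
      then show ?thesis using \<open>0 < C\<close> by simp
    qed
    then show "\<exists>C>0. \<forall>a. summable (\<lambda>n. \<bar>a n\<bar>) \<and> (\<Sum>n. \<bar>a n\<bar>) \<le> 1 \<and> \<delta> < norm (\<Sum>n. a n *\<^sub>R y n) \<longrightarrow>
        (\<forall>\<epsilon>. (\<forall>n. \<epsilon> n \<in> {-1, 1}) \<longrightarrow> C < norm (\<Sum>n. (\<epsilon> n * a n) *\<^sub>R y n))"
      using \<open>0 < C\<close> by (intro exI[of _ "C / 2"]) auto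
  qed
qed

section \<open>Application to weakly null sequences\<close>

theorem theoremA:
  fixes x :: "nat \<Rightarrow> 'a::banach"
  assumes "normalized x" and "weakly_null x"
  shows "\<exists>r :: nat \<Rightarrow> nat. strict_mono r \<and> convexly_unconditional (x \<circ> r)"
proof -
  obtain \<U> where "nat_ultrafilter \<U>" using ex_nat_ultrafilter by blast
  then interpret nat_ultrafilter \<U> .
  define K where "K = {f :: 'a \<Rightarrow>\<^sub>L real. norm f \<le> 1}"
  define A where "A i n = {f :: 'a \<Rightarrow>\<^sub>L real. (1/2)^i \<le> blinfun_apply f (x n)}" for i n
  define B where "B k c n = {f :: 'a \<Rightarrow>\<^sub>L real. if c then - ((1/4)^k / 8) \<le> blinfun_apply f (x n)
    else blinfun_apply f (x n) \<le> (1/4)^k / 8}" for k c n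
  interpret selection \<U> K A B
  proof
    fix L :: "nat set" and k c assume "infinite L"
    then obtain S where S: "finite S" "S \<subseteq> L"
      "\<And>f :: 'a \<Rightarrow>\<^sub>L real. norm f \<le> 1 \<Longrightarrow> \<exists>n\<in>S. blinfun_apply f (x n) \<le> (1/4)^k / 8"
      using weakly_null_finite_cover[OF assms(2), of L "(1/4)^k / 8"] by auto
    \<comment> \<open>The side \<open>c = True\<close> asks for a lower bound on \<open>f\<close>,
      which is the upper bound for \<open>- f\<close>, again a member of the ball.\<close>
    have "\<exists>n\<in>S. f \<in> B k c n" if "f \<in> K" for f
    proof (cases c)
      case True
      have "norm (- f) \<le> 1" using that unfolding K_def by simp
      then obtain n where "n \<in> S" "blinfun_apply (- f) (x n) \<le> (1/4)^k / 8" using S(3) by blast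
      then show ?thesis using True unfolding B_def by (intro bexI[of _ n]) (auto simp: blinfun.minus_left)
    next
      case False
      then show ?thesis using S(3)[of f] that unfolding B_def K_def by auto
    qed
    then have "K \<subseteq> (\<Union>n\<in>S. B k c n)" by (intro subsetI) simp
    with S(1,2) show "\<exists>S. finite S \<and> S \<subseteq> L \<and> K \<subseteq> (\<Union>n\<in>S. B k c n)"
      by (intro exI[of _ S] conjI)
  qed
  have mem: "f \<in> K \<longleftrightarrow> norm f \<le> 1" "f \<in> A i n \<longleftrightarrow> (1/2)^i \<le> blinfun_apply f (x n)"
    "f \<in> B k c n \<longleftrightarrow> (if c then - ((1/4)^k / 8) \<le> blinfun_apply f (x n)
      else blinfun_apply f (x n) \<le> (1/4)^k / 8)" for f i n k c
    unfolding K_def A_def B_def by simp_all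
  have "one_sided_suppression (x \<circ> sel)"
  proof
    show "norm ((x \<circ> sel) n) = 1" for n using assms(1) unfolding normalized_def by simp
    fix F i N and f :: "'a \<Rightarrow>\<^sub>L real" and c
    assume "F \<subseteq> {i..<N}" "norm f \<le> 1" "\<forall>j\<in>F. (1/2)^i \<le> blinfun_apply f ((x \<circ> sel) j)"
    then show "\<exists>g :: 'a \<Rightarrow>\<^sub>L real. norm g \<le> 1 \<and> (\<forall>j\<in>F. (1/2)^i \<le> blinfun_apply g ((x \<circ> sel) j)) \<and>
        (\<forall>j\<in>{i..<N} - F. if c j then - ((1/4)^j / 8) \<le> blinfun_apply g ((x \<circ> sel) j)
          else blinfun_apply g ((x \<circ> sel) j) \<le> (1/4)^j / 8)"
      using selection[of F i N c] unfolding mem Bex_def comp_apply by blast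
  qed
  then show ?thesis
    using strict_mono_sel convexly_unconditional_of_suppression by blast
qed

end
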